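(* For any positive integer constant $c$ and any adaptive deterministic $c$-correct algorithm $\mathcal{A}$ that finds spanning forests in simple graphs, for any positive integer $m$ sufficiently large depending on $c$, and for any simple forest $G$ with $m$ edges, there is a strategy of the adversary for activating stations that forces $\mathcal{A}$ to perform $\Omega(m\log m)$ steps on input $G$ when run against this strategy.
   Context: Dynamic (adversarial) model: the input is a simple graph (no weights) on vertex set $\{1,\dots,n\}$, $n$ known to all stations; each edge is held by exactly one station, each station holds one edge and has a distinct ID. Computation is synchronous with a global clock started at the first step. Stations are passive or active; only active stations act and receive channel feedback. An adversary decides at which step each passive station becomes active (several or none per step; at least one station is active at the first step); an activated station knows it was activated and the current step number. In each step each active station broadcasts a message (of arbitrary size) or not; if exactly one broadcasts, its message is heard by all active stations; if none, silence; if two or more, a collision signal distinct from silence. The algorithm terminates at the step when some station successfully broadcasts a special termination signal. The output is the set of edges heard on the channel. For an integer $c>0$, the closing $c$ steps are the last $c$ steps up to termination; an algorithm is $c$-correct if its output contains a spanning forest (maximal acyclic subgraph) of the graph formed by the edges held by stations activated before the closing $c$ steps. A deterministic adaptive algorithm: each station's action is a deterministic function of $n$, its ID, its edge, its activation step, and the feedback heard while active.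
   Formalization: The algorithm is additionally assumed to announce on the channel only edges of the input graph; otherwise one message listing all pairs of vertices would be c-correct after O(log n) steps and the bound would fail. *)

theory Defs
  imports Complex_Main
begin

section \<open>Simple graphs and forests\<close>

text \<open>A graph on the vertex set \<open>{1..n}\<close> is represented by its set of edges.\<close>

type_synonym edge = "nat set"

definition simple_graph :: "nat \<Rightarrow> edge set \<Rightarrow> bool" where
  "simple_graph n E \<longleftrightarrow> (\<forall>e\<in>E. e \<subseteq> {1..n} \<and> card e = 2)"

definition cycle_in :: "edge set \<Rightarrow> nat list \<Rightarrow> bool" where
  "cycle_in E vs \<longleftrightarrow> 3 \<le> length vs \<and> distinct vs \<and>
     (\<forall>i<length vs. {vs ! i, vs ! (Suc i mod length vs)} \<in> E)"

definition forest :: "edge set \<Rightarrow> bool" where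
  "forest E \<longleftrightarrow> (\<nexists>vs. cycle_in E vs)"

definition spanning_forest :: "edge set \<Rightarrow> edge set \<Rightarrow> bool" where
  "spanning_forest E F \<longleftrightarrow>
     F \<subseteq> E \<and> forest F \<and> (\<forall>F'. F \<subset> F' \<and> F' \<subseteq> E \<longrightarrow> \<not> forest F')"

section \<open>Inputs and activation schedules\<close>

text \<open>Stations are identified with their IDs, which are natural numbers.
  An input maps the ID of every station to the edge it holds.\<close>

type_synonym assignment = "nat \<rightharpoonup> edge"

definition distributes :: "edge set \<Rightarrow> assignment \<Rightarrow> bool" where
  "distributes E hold \<longleftrightarrow> inj_on hold (dom hold) \<and> ran hold = E"

text \<open>Steps are numbered 1, 2, ...  Against a fixed deterministic algorithm, a strategy of the
  adversary amounts to the resulting schedule, which gives the activation step of every station.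
  Activation after the termination step has the same effect as no activation.\<close>

type_synonym schedule = "nat \<Rightarrow> nat"

definition valid_schedule :: "assignment \<Rightarrow> schedule \<Rightarrow> bool" where
  "valid_schedule hold act \<longleftrightarrow>
     (\<forall>s\<in>dom hold. 1 \<le> act s) \<and> (\<exists>s\<in>dom hold. act s = 1)"

section \<open>Algorithms and their runs on the channel\<close>

text \<open>A message lists edges and carries a bit string of arbitrary length; the flag tells
  whether it is the termination signal.\<close>

datatype message =
  Message (announced: "edge set") (payload: "bool list") (terminal: bool)

datatype feedback = Silence | Heard message | Collision

text \<open>The arguments of an algorithm are \<open>n\<close>, the ID, the edge, the activation step and the
  feedback of the steps from activation up to the preceding step (so that the current step
  number is determined). The result \<open>None\<close> means not to broadcast.\<close>

type_synonym algorithm =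
  "nat \<Rightarrow> nat \<Rightarrow> edge \<Rightarrow> nat \<Rightarrow> feedback list \<Rightarrow> message option"

text \<open>Here \<open>h\<close> is the list of feedbacks of the steps 1 to \<open>length h\<close>, and the action
  is the one at step \<open>length h + 1\<close>. A station already acts at its activation step.\<close>

definition action ::
  "algorithm \<Rightarrow> nat \<Rightarrow> assignment \<Rightarrow> schedule \<Rightarrow> feedback list \<Rightarrow> nat \<Rightarrow> message option" where
  "action A n hold act h s =
     (case hold s of
        None \<Rightarrow> None
      | Some e \<Rightarrow>
          if act s \<le> length h + 1 then A n s e (act s) (drop (act s - 1) h) else None)"

definition channel_feedback ::
  "algorithm \<Rightarrow> nat \<Rightarrow> assignment \<Rightarrow> schedule \<Rightarrow> feedback list \<Rightarrow> feedback" where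
  "channel_feedback A n hold act h =
     (let B = {s. action A n hold act h s \<noteq> None}
      in if B = {} then Silence
         else if card B = 1 then Heard (the (action A n hold act h (the_elem B)))
         else Collision)"

primrec transcript ::
  "algorithm \<Rightarrow> nat \<Rightarrow> assignment \<Rightarrow> schedule \<Rightarrow> nat \<Rightarrow> feedback list" where
  "transcript A n hold act 0 = []"
| "transcript A n hold act (Suc t) =
     transcript A n hold act t @ [channel_feedback A n hold act (transcript A n hold act t)]"

definition termination_heard :: "feedback \<Rightarrow> bool" where
  "termination_heard f \<longleftrightarrow> (\<exists>msg. f = Heard msg \<and> terminal msg)"

definition terminates_at ::
  "algorithm \<Rightarrow> nat \<Rightarrow> assignment \<Rightarrow> schedule \<Rightarrow> nat \<Rightarrow> bool" where
  "terminates_at A n hold act T \<longleftrightarrow>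
     1 \<le> T \<and> termination_heard (last (transcript A n hold act T)) \<and>
     (\<forall>f \<in> set (transcript A n hold act (T - 1)). \<not> termination_heard f)"

definition edges_heard ::
  "algorithm \<Rightarrow> nat \<Rightarrow> assignment \<Rightarrow> schedule \<Rightarrow> nat \<Rightarrow> edge set" where
  "edges_heard A n hold act T =
     \<Union> {announced msg | msg. Heard msg \<in> set (transcript A n hold act T)}"

section \<open>Correctness\<close>

text \<open>The closing \<open>c\<close> steps are \<open>T - c + 1, ..., T\<close>.\<close>

definition edges_before_closing :: "nat \<Rightarrow> assignment \<Rightarrow> schedule \<Rightarrow> nat \<Rightarrow> edge set" where
  "edges_before_closing c hold act T = {e. \<exists>s. hold s = Some e \<and> act s + c \<le> T}"

definition c_correct :: "nat \<Rightarrow> algorithm \<Rightarrow> bool" where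
  "c_correct c A \<longleftrightarrow>
     (\<forall>n E hold act.
        simple_graph n E \<and> distributes E hold \<and> valid_schedule hold act \<longrightarrow>
        (\<exists>T. terminates_at A n hold act T \<and>
             (\<exists>F. spanning_forest (edges_before_closing c hold act T) F \<and>
                  F \<subseteq> edges_heard A n hold act T)))"

text \<open>Messages are otherwise unrestricted, so it has to be said that the edges heard are edges
  of the input graph: a single message listing all pairs of vertices would make the output
  contain a spanning forest of any graph. A message may list edges of other stations, whether
  learned from earlier messages or deduced from the feedback.\<close>

definition outputs_input_edges :: "algorithm \<Rightarrow> bool" where
  "outputs_input_edges A \<longleftrightarrow>
     (\<forall>n E hold act T.
        simple_graph n E \<and> distributes E hold \<and> valid_schedule hold act \<and>
        terminates_at A n hold act T \<longrightarrow>
        edges_heard A n hold act T \<subseteq> E)"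

end

theory Submission
  imports Defs
begin

text \<open>The adversary activates stations in pairs, one pair every \<open>l\<close> steps where
  \<open>l\<close> is about half of \<open>log 2 m\<close>, but leaves open which pair it has activated: it keeps
  a set of candidates that have all behaved alike, any two of which explain the feedback so far. In
  every step the majority of the candidates (broadcasting or silent) survives; broadcasting ones
  yield a collision. As long as three candidates are left, the algorithm cannot announce the edge
  of any one of them, since the same feedback arises on an input without that edge; so it cannot
  terminate once the candidates have been active for \<open>c\<close> steps. The candidates for the next pair
  are introduced \<open>c\<close> steps before the current pair is fixed, which bridges the closing steps.\<close>

section \<open>Forests, channel feedback and termination\<close>

lemma forest_subset: "forest E \<Longrightarrow> F \<subseteq> E \<Longrightarrow> forest F"
  unfolding forest_def cycle_in_def by blast

lemma spanning_forest_of_forest: "forest E \<Longrightarrow> spanning_forest E F \<Longrightarrow> F = E"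
  unfolding spanning_forest_def by blast

text \<open>Leaving stations out is modelled by restricting \<open>hold\<close>: the remaining
  stations react to the same feedback as before, so runs on different subsets can be
  compared.\<close>

lemma action_restrict:
  "action A n (hold |` D) act h s = (if s \<in> D then action A n hold act h s else None)"
  by (simp add: action_def restrict_map_def)

lemma action_cong:
  "act s = act' s \<Longrightarrow> action A n hold act h s = action A n hold act' h s"
  by (simp add: action_def split: option.split)

lemma action_before_activation:
  "length h + 1 < act s \<Longrightarrow> action A n hold act h s = None"
  by (simp add: action_def split: option.split)

lemma channel_feedback_cong:
  assumes "\<And>s. action A n hold act h s = action A n hold' act' h s"
  shows "channel_feedback A n hold act h = channel_feedback A n hold' act' h"
proof -
  have "action A n hold act h = action A n hold' act' h" using assms by blast
  then show ?thesis unfolding channel_feedback_def by metis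
qed

lemma channel_feedback_collision:
  assumes "finite (dom hold)" "x \<noteq> y"
    "action A n hold act h x \<noteq> None" "action A n hold act h y \<noteq> None"
  shows "channel_feedback A n hold act h = Collision"
proof -
  let ?B = "{s. action A n hold act h s \<noteq> None}"
  have "?B \<subseteq> dom hold" by (auto simp: action_def split: option.splits)
  then have "finite ?B" using assms(1) finite_subset by blast
  moreover have "{x, y} \<subseteq> ?B" using assms by simp
  ultimately have "2 \<le> card ?B" using assms(2) by (metis card_2_iff card_mono)
  then show ?thesis using assms(3) by (auto simp: channel_feedback_def Let_def)
qed

lemma length_transcript [simp]: "length (transcript A n hold act t) = t"
  by (induction t) auto

lemma take_transcript: "i \<le> t \<Longrightarrow> take i (transcript A n hold act t) = transcript A n hold act i"
  by (induction t) (auto simp: le_Suc_eq)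

text \<open>Each feedback is determined by the earlier ones, so a list devised by the adversary is
  the actual transcript once every entry fits its own prefix.\<close>

lemma transcript_eqI:
  assumes "\<And>i. i < length h \<Longrightarrow> h ! i = channel_feedback A n hold act (take i h)"
  shows "transcript A n hold act (length h) = h"
proof -
  have "transcript A n hold act i = take i h" if "i \<le> length h" for i
    using that
  proof (induction i)
    case (Suc i)
    then show ?case using assms[of i] by (simp add: take_Suc_conv_app_nth)
  qed simp
  then show ?thesis by simp
qed

definition quiet :: "feedback list \<Rightarrow> bool" where
  "quiet h \<longleftrightarrow> (\<forall>f\<in>set h. \<not> termination_heard f)"

lemma terminates_atD_quiet:
  assumes "terminates_at A n hold act T" "quiet (transcript A n hold act t)"
  shows "t < T"
proof (rule ccontr)
  assume "\<not> t < T"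
  then have "transcript A n hold act T = take T (transcript A n hold act t)"
    by (simp add: take_transcript)
  moreover have "1 \<le> T" using assms(1) by (simp add: terminates_at_def)
  then have "transcript A n hold act T \<noteq> []"
    by (metis length_0_conv length_transcript not_one_le_zero)
  ultimately have "last (transcript A n hold act T) \<in> set (transcript A n hold act t)"
    by (metis in_set_takeD last_in_set)
  then show False using assms by (auto simp: terminates_at_def quiet_def)
qed

lemma terminates_at_unique:
  assumes "terminates_at A n hold act T" "terminates_at A n hold act T'"
  shows "T = T'"
proof -
  have "T - 1 < T'" if "terminates_at A n hold act T" "terminates_at A n hold act T'" for T T'
    using that terminates_atD_quiet[of A n hold act T' "T - 1"]
    by (auto simp: terminates_at_def quiet_def)
  from this[OF assms] this[OF assms(2,1)] show ?thesis using assms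
    by (auto simp: terminates_at_def)
qed

section \<open>Candidate sets that explain the feedback\<close>

abbreviation group :: "schedule \<Rightarrow> nat set \<Rightarrow> nat \<Rightarrow> nat set" where
  "group act C a \<equiv> {s \<in> C. act s = a}"

text \<open>\<open>hold\<close> is one fixed input, whereas \<open>c_correct\<close> and
  \<open>outputs_input_edges\<close> speak of all inputs; they are applied below to restrictions of
  \<open>hold\<close> as well.\<close>

locale adversary =
  fixes A :: algorithm and n :: nat and hold :: assignment and c :: nat
  assumes finite_stations: "finite (dom hold)"
    and inj_hold: "inj_on hold (dom hold)"
    and simple: "simple_graph n (ran hold)"
    and forest: "forest (ran hold)"
    and correct: "c_correct c A"
    and outputs: "outputs_input_edges A"
begin

definition broadcasts :: "schedule \<Rightarrow> feedback list \<Rightarrow> nat \<Rightarrow> bool" where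
  "broadcasts act h s \<longleftrightarrow> action A n hold act h s \<noteq> None"

text \<open>The stations in \<open>Q\<close> are definitely activated; the candidates in \<open>C\<close> are grouped by
  activation step, and \<open>h\<close> is the feedback if at least two candidates of each group are
  activated.\<close>

definition consistent :: "schedule \<Rightarrow> nat set \<Rightarrow> nat set \<Rightarrow> feedback list \<Rightarrow> bool" where
  "consistent act Q C h \<longleftrightarrow>
     (\<forall>i<length h.
        (\<forall>s\<in>C. \<forall>s'\<in>C. act s = act s' \<longrightarrow>
            broadcasts act (take i h) s = broadcasts act (take i h) s') \<and>
        h ! i = (if \<exists>s\<in>C. broadcasts act (take i h) s then Collision
                 else channel_feedback A n (hold |` Q) act (take i h)))"

lemma consistent_same:
  assumes "consistent act Q C h" "i < length h" "s \<in> C" "s' \<in> C" "act s = act s'"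
  shows "broadcasts act (take i h) s = broadcasts act (take i h) s'"
  using assms(1)[unfolded consistent_def, THEN spec, THEN mp, OF assms(2), THEN conjunct1]
    assms(3-) by blast

lemma consistent_feedback:
  assumes "consistent act Q C h" "i < length h"
  shows "h ! i = (if \<exists>s\<in>C. broadcasts act (take i h) s then Collision
                  else channel_feedback A n (hold |` Q) act (take i h))"
  using assms(1)[unfolded consistent_def, THEN spec, THEN mp, OF assms(2), THEN conjunct2] .

lemma consistentI:
  assumes "\<And>i s s'. i < length h \<Longrightarrow> s \<in> C \<Longrightarrow> s' \<in> C \<Longrightarrow> act s = act s' \<Longrightarrow>
      broadcasts act (take i h) s = broadcasts act (take i h) s'"
    and "\<And>i. i < length h \<Longrightarrow>
      h ! i = (if \<exists>s\<in>C. broadcasts act (take i h) s then Collision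
               else channel_feedback A n (hold |` Q) act (take i h))"
  shows "consistent act Q C h"
  unfolding consistent_def using assms by (intro allI impI conjI ballI)

text \<open>Since the members of a group have acted alike, discarding candidates loses no recorded
  collision as long as each group keeps a member.\<close>

lemma consistent_subset:
  assumes "consistent act Q C h" "C' \<subseteq> C" "\<And>s. s \<in> C \<Longrightarrow> \<exists>s'\<in>C'. act s' = act s"
  shows "consistent act Q C' h"
proof (rule consistentI)
  fix i assume i: "i < length h"
  let ?b = "broadcasts act (take i h)"
  show "?b s = ?b s'" if "s \<in> C'" "s' \<in> C'" "act s = act s'" for s s'
    using consistent_same[OF assms(1) i] that assms(2) by blast
  have "\<exists>s'\<in>C'. ?b s'" if s: "s \<in> C" "?b s" for s
  proof -
    obtain s' where s': "s' \<in> C'" "act s' = act s" using assms(3) s(1) by blast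
    then have "?b s' = ?b s" using consistent_same[OF assms(1) i] s(1) assms(2) by blast
    then show ?thesis using s'(1) s(2) by blast
  qed
  then have "(\<exists>s\<in>C. ?b s) = (\<exists>s\<in>C'. ?b s)" using assms(2) by blast
  then show "h ! i = (if \<exists>s\<in>C'. ?b s then Collision
                 else channel_feedback A n (hold |` Q) act (take i h))"
    using consistent_feedback[OF assms(1) i] by simp
qed

text \<open>Two chosen members of each group in \<open>P\<close> reproduce every collision that the
  group caused, and where the group was silent they add nothing to the channel. Hence
  \<open>D\<close> can be made definite and the rest of \<open>P\<close> dropped without changing
  \<open>h\<close>.\<close>

lemma consistent_commit:
  assumes con: "consistent act Q C h" and "P \<subseteq> C" "D \<subseteq> P"
    and two: "\<And>s. s \<in> P \<Longrightarrow> \<exists>x\<in>D. \<exists>y\<in>D. x \<noteq> y \<and> act x = act s \<and> act y = act s"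
  shows "consistent act (Q \<union> D) (C - P) h"
proof (rule consistentI)
  fix i assume i: "i < length h"
  let ?b = "broadcasts act (take i h)"
  note same = consistent_same[OF con i] and hi = consistent_feedback[OF con i]
  show "?b s = ?b s'" if "s \<in> C - P" "s' \<in> C - P" "act s = act s'" for s s'
    using same that by blast
  show "h ! i = (if \<exists>s\<in>C - P. ?b s then Collision
                 else channel_feedback A n (hold |` (Q \<union> D)) act (take i h))"
  proof (cases "\<exists>s\<in>C - P. ?b s")
    case True
    then show ?thesis using hi by auto
  next
    case none_outside: False
    show ?thesis
    proof (cases "\<exists>s\<in>P. ?b s")
      case True
      then obtain s where s: "s \<in> P" "?b s" by blast
      then obtain x y where xy: "x \<in> D" "y \<in> D" "x \<noteq> y" "act x = act s" "act y = act s"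
        using two by blast
      have "x \<in> C" "y \<in> C" "s \<in> C" using xy(1,2) s(1) assms(2,3) by auto
      then have "?b x" "?b y" using same[of x s] same[of y s] s(2) xy(4,5) by auto
      then have "channel_feedback A n (hold |` (Q \<union> D)) act (take i h) = Collision"
        using xy finite_stations
        by (intro channel_feedback_collision[of _ x y]) (auto simp: action_restrict broadcasts_def)
      then show ?thesis using none_outside hi s assms(2) by auto
    next
      case False
      then have "h ! i = channel_feedback A n (hold |` Q) act (take i h)"
        using none_outside hi by auto
      also have "\<dots> = channel_feedback A n (hold |` (Q \<union> D)) act (take i h)"
        using False assms(3)
        by (intro channel_feedback_cong) (auto simp: action_restrict broadcasts_def)
      finally show ?thesis using none_outside by simp
    qed
  qed
qed

text \<open>Committing with \<open>P = C\<close> leaves no candidates, and consistency then says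
  that \<open>h\<close> is the real feedback.\<close>

lemma transcript_consistent:
  assumes "consistent act Q C h" "D \<subseteq> C"
    and "\<And>s. s \<in> C \<Longrightarrow> \<exists>x\<in>D. \<exists>y\<in>D. x \<noteq> y \<and> act x = act s \<and> act y = act s"
  shows "transcript A n (hold |` (Q \<union> D)) act (length h) = h"
proof (rule transcript_eqI)
  have "consistent act (Q \<union> D) (C - C) h" using assms by (intro consistent_commit) auto
  then show "h ! i = channel_feedback A n (hold |` (Q \<union> D)) act (take i h)"
    if "i < length h" for i using consistent_feedback that by fastforce
qed

text \<open>Stations starting at step \<open>length h + 1\<close> are silent in all steps recorded
  by \<open>h\<close>, so they can join the candidates without affecting the past.\<close>

lemma consistent_activate:
  assumes con: "consistent act Q C h" and "S \<inter> (Q \<union> C) = {}"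
    and eq: "\<And>s. s \<in> Q \<union> C \<Longrightarrow> act' s = act s"
    and S: "\<And>s. s \<in> S \<Longrightarrow> act' s = length h + 1"
  shows "consistent act' Q (C \<union> S) h"
proof (rule consistentI)
  fix i assume i: "i < length h"
  let ?b = "broadcasts act (take i h)" and ?b' = "broadcasts act' (take i h)"
  have late: "\<not> ?b' s" if "act' s = length h + 1" for s
    using that i by (simp add: broadcasts_def action_before_activation)
  have C: "?b' s = ?b s" if "s \<in> C" for s
    using that eq[of s] unfolding broadcasts_def by (metis UnCI action_cong)
  have "channel_feedback A n (hold |` Q) act' (take i h)
      = channel_feedback A n (hold |` Q) act (take i h)"
    by (intro channel_feedback_cong) (auto simp: action_restrict intro!: action_cong eq)
  moreover have "(\<exists>s\<in>C \<union> S. ?b' s) = (\<exists>s\<in>C. ?b s)" using C late S by blast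
  ultimately show "h ! i = (if \<exists>s\<in>C \<union> S. ?b' s then Collision
                 else channel_feedback A n (hold |` Q) act' (take i h))"
    using consistent_feedback[OF con i] by simp
  show "?b' s = ?b' s'" if "s \<in> C \<union> S" "s' \<in> C \<union> S" "act' s = act' s'" for s s'
  proof (cases "s \<in> S \<or> s' \<in> S")
    case True
    then have "act' s = length h + 1" "act' s' = length h + 1" using that(3) S by auto
    then show ?thesis using late by blast
  next
    case False
    then have "s \<in> C" "s' \<in> C" using that by auto
    then show ?thesis using consistent_same[OF con i, of s s'] C eq[of s] eq[of s'] that(3) by simp
  qed
qed

text \<open>A majority vote in each group on whether to broadcast keeps at least half of it. The
  survivors of a group act alike by construction, and a survivor in every group keeps the earlier
  feedback explained.\<close>

lemma consistent_step:
  assumes con: "consistent act Q C h" and "finite C"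
  shows "\<exists>C' f. C' \<subseteq> C \<and> (\<forall>a. card (group act C a) \<le> 2 * card (group act C' a)) \<and>
    ((\<forall>s\<in>C. \<exists>s'\<in>C'. act s' = act s) \<longrightarrow> consistent act Q C' (h @ [f]))"
proof -
  let ?b = "broadcasts act h"
  \<comment> \<open>Each group votes on its own; a tie counts as broadcasting.\<close>
  let ?maj = "\<lambda>a. card (group act C a) \<le> 2 * card {s \<in> group act C a. ?b s}"
  define C' where "C' = {s \<in> C. ?b s = ?maj (act s)}"
  define f where "f = (if \<exists>s\<in>C'. ?b s then Collision else channel_feedback A n (hold |` Q) act h)"
  have "card (group act C a) \<le> 2 * card (group act C' a)" for a
  proof (cases "?maj a")
    case True
    then have "group act C' a = {s \<in> group act C a. ?b s}" by (auto simp: C'_def)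
    then show ?thesis using True by simp
  next
    case False
    then have "group act C' a = group act C a - {s \<in> group act C a. ?b s}" by (auto simp: C'_def)
    then have "card (group act C' a) = card (group act C a) - card {s \<in> group act C a. ?b s}"
      using \<open>finite C\<close> by (auto intro!: card_Diff_subset)
    then show ?thesis using False by linarith
  qed
  moreover have "C' \<subseteq> C" by (auto simp: C'_def)
  moreover have "consistent act Q C' (h @ [f])" if "\<forall>s\<in>C. \<exists>s'\<in>C'. act s' = act s"
  proof -
    have "consistent act Q C' h" using consistent_subset con that \<open>C' \<subseteq> C\<close> by blast
    note same = consistent_same[OF this] and feedback = consistent_feedback[OF this]
    show ?thesis
    proof (rule consistentI)
      fix i assume "i < length (h @ [f])"
      then consider "i < length h" | "i = length h" by fastforce
      note i = this
      show "broadcasts act (take i (h @ [f])) s = broadcasts act (take i (h @ [f])) s'"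
        if "s \<in> C'" "s' \<in> C'" "act s = act s'" for s s'
        using i by cases (use that same[of i s s'] in \<open>simp_all add: C'_def\<close>)
      show "(h @ [f]) ! i =
          (if \<exists>s\<in>C'. broadcasts act (take i (h @ [f])) s then Collision
           else channel_feedback A n (hold |` Q) act (take i (h @ [f])))"
        using i by cases (use feedback[of i] in \<open>simp_all add: nth_append f_def\<close>)
    qed
  qed
  ultimately show ?thesis by blast
qed

section \<open>Indistinguishable inputs prevent termination\<close>

lemma restricted_input:
  assumes "D \<subseteq> dom hold"
  shows "simple_graph n (ran (hold |` D))" "distributes (ran (hold |` D)) (hold |` D)"
proof -
  have "ran (hold |` D) \<subseteq> ran hold" by (auto simp: ran_def restrict_map_def)
  then show "simple_graph n (ran (hold |` D))" using simple by (auto simp: simple_graph_def)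
  show "distributes (ran (hold |` D)) (hold |` D)"
    using inj_hold by (simp add: distributes_def inj_on_def)
qed

text \<open>A subgraph of a forest is its own only spanning forest, so correctness forces every edge
  from before the closing steps to be announced.\<close>

lemma terminated_correct:
  assumes D: "D \<subseteq> dom hold" and valid: "valid_schedule (hold |` D) act"
    and T: "terminates_at A n (hold |` D) act T"
  shows "edges_before_closing c (hold |` D) act T \<subseteq> edges_heard A n (hold |` D) act T"
    and "edges_heard A n (hold |` D) act T \<subseteq> ran (hold |` D)"
proof -
  show "edges_heard A n (hold |` D) act T \<subseteq> ran (hold |` D)"
    using outputs[unfolded outputs_input_edges_def] restricted_input[OF D] valid T by blast
  obtain T' F where T': "terminates_at A n (hold |` D) act T'"
    and F: "spanning_forest (edges_before_closing c (hold |` D) act T') F"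
      "F \<subseteq> edges_heard A n (hold |` D) act T'"
    using correct[unfolded c_correct_def] restricted_input[OF D] valid by blast
  have "edges_before_closing c (hold |` D) act T' \<subseteq> ran hold"
    by (auto simp: edges_before_closing_def restrict_map_def ran_def split: if_splits)
  then have "F = edges_before_closing c (hold |` D) act T'"
    using F(1) forest forest_subset spanning_forest_of_forest by blast
  moreover have "T' = T" using T T' by (rule terminates_at_unique[rotated])
  ultimately show "edges_before_closing c (hold |` D) act T \<subseteq> edges_heard A n (hold |` D) act T"
    using F(2) by simp
qed

text \<open>Compare the runs with and without a candidate \<open>x\<close> that was active before
  the closing steps. Both have feedback \<open>h @ [f]\<close>. A termination signal in
  \<open>f\<close> would end both at the same step with the same announced edges; these must contain
  the edge of \<open>x\<close> in the first run and cannot contain it in the second.\<close>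

lemma consistent_not_terminated:
  assumes con: "consistent act Q C (h @ [f])" and "quiet h"
    and sub: "Q \<union> C \<subseteq> dom hold" and disj: "Q \<inter> C = {}"
    and pos: "\<And>s. s \<in> Q \<union> C \<Longrightarrow> 1 \<le> act s" and first: "\<exists>s\<in>Q \<union> C. act s = 1"
    and three: "\<And>s. s \<in> C \<Longrightarrow> 3 \<le> card (group act C (act s))"
    and active: "Q = {} \<or> (\<exists>s\<in>C. act s + c \<le> length h + 1)"
  shows "quiet (h @ [f])"
proof (cases "Q = {}")
  case True
  \<comment> \<open>Without definite stations the feedback is a collision or silence, never a
    message.\<close>
  have "(h @ [f]) ! length h = (if \<exists>s\<in>C. broadcasts act h s then Collision
                 else channel_feedback A n (hold |` Q) act h)"
    using consistent_feedback[OF con, of "length h"] by (simp del: nth_append_length)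
  moreover have "channel_feedback A n (hold |` Q) act h = Silence"
    using True by (simp add: channel_feedback_def action_def)
  ultimately have "\<not> termination_heard f" by (auto simp: termination_heard_def)
  then show ?thesis using \<open>quiet h\<close> by (simp add: quiet_def)
next
  case False
  then obtain x where x: "x \<in> C" "act x + c \<le> length h + 1" using active by blast
  have "finite C" using sub finite_stations finite_subset by blast
  \<comment> \<open>A group of three still has two members after \<open>x\<close> is removed, hence
    causes the same collisions.\<close>
  have two: "\<exists>y\<in>C - {x}. \<exists>z\<in>C - {x}. y \<noteq> z \<and> act y = act s \<and> act z = act s"
    if "s \<in> C" for s
  proof -
    have "card (group act C (act s)) - 1 \<le> card (group act C (act s) - {x})"
      using card_Diff1_le by (simp add: card_Diff_singleton_if)
    then have "2 \<le> card (group act C (act s) - {x})" using three[OF that] by linarith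
    then obtain B where "B \<subseteq> group act C (act s) - {x}" "card B = 2"
      by (meson obtain_subset_with_card_n)
    then obtain y z where "y \<noteq> z" "{y, z} \<subseteq> group act C (act s) - {x}"
      by (auto simp: card_2_iff)
    then show ?thesis by blast
  qed
  have two': "\<exists>y\<in>C. \<exists>z\<in>C. y \<noteq> z \<and> act y = act s \<and> act z = act s" if "s \<in> C" for s
    using two[OF that] by blast
  have "\<not> termination_heard f"
  proof
    assume f: "termination_heard f"
    let ?T = "Suc (length h)"
    let ?D = "Q \<union> C" and ?D' = "Q \<union> (C - {x})"
    have tr: "transcript A n (hold |` ?D) act ?T = h @ [f]"
      using transcript_consistent[OF con order_refl two'] by (simp only: length_append_singleton)
    have tr': "transcript A n (hold |` ?D') act ?T = h @ [f]"
      using transcript_consistent[OF con Diff_subset two] by (simp only: length_append_singleton)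
    have "transcript A n (hold |` ?D) act (length h) = h"
      "transcript A n (hold |` ?D') act (length h) = h"
      using tr tr' by (simp_all only: transcript.simps append1_eq_conv)
    then have T: "terminates_at A n (hold |` ?D) act ?T"
      and T': "terminates_at A n (hold |` ?D') act ?T"
      using tr tr' f \<open>quiet h\<close> by (auto simp: terminates_at_def quiet_def)
    \<comment> \<open>If \<open>x\<close> itself started at step 1, another member of its group did
      so too.\<close>
    have "\<exists>s\<in>?D'. act s = 1"
    proof -
      obtain s where "s \<in> Q \<or> s \<in> C" "act s = 1" using first by blast
      then show ?thesis using two[of s] by auto
    qed
    then have v: "valid_schedule (hold |` ?D) act" and v': "valid_schedule (hold |` ?D') act"
      using pos sub by (auto simp: valid_schedule_def)
    obtain e where e: "hold x = Some e" using x sub by blast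
    then have "e \<in> edges_before_closing c (hold |` ?D) act ?T"
      using x by (auto simp: edges_before_closing_def restrict_map_def)
    then have "e \<in> edges_heard A n (hold |` ?D) act ?T"
      using terminated_correct(1)[OF sub v T] by blast
    then have "e \<in> edges_heard A n (hold |` ?D') act ?T"
      unfolding edges_heard_def tr tr' .
    moreover have "?D' \<subseteq> dom hold" using sub by blast
    ultimately have "e \<in> ran (hold |` ?D')"
      using terminated_correct(2)[OF _ v' T'] by blast
    then obtain s where "s \<in> ?D'" "hold s = Some e"
      by (auto simp: ran_def restrict_map_def split: if_splits)
    moreover from this have "s = x" using e inj_onD[OF inj_hold, of s x] by auto
    ultimately show False using x(1) disj by blast
  qed
  then show ?thesis using \<open>quiet h\<close> by (simp add: quiet_def)
qed

section \<open>Several steps in a row\<close>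

text \<open>Under these conditions \<open>Q\<close> with at least two candidates of every group is a
  legal input whose run so far has feedback \<open>h\<close> and has not ended.\<close>

definition feasible :: "schedule \<Rightarrow> nat set \<Rightarrow> nat set \<Rightarrow> feedback list \<Rightarrow> bool" where
  "feasible act Q C h \<longleftrightarrow> consistent act Q C h \<and> quiet h \<and> Q \<union> C \<subseteq> dom hold \<and> Q \<inter> C = {} \<and>
     (\<forall>s\<in>Q \<union> C. 1 \<le> act s) \<and> (\<exists>s\<in>Q \<union> C. act s = 1)"

text \<open>Each step at most halves every group, so groups of size \<open>3 * 2 ^ k\<close> keep
  the three members needed against termination for \<open>k\<close> steps. The loss is bounded
  separately for each activation step because two generations of candidates will coexist.\<close>

lemma feasible_steps:
  assumes "feasible act Q C h" "\<forall>s\<in>C. 3 * 2 ^ k \<le> card (group act C (act s))"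
    "Q = {} \<or> (\<exists>s\<in>C. act s + c \<le> length h + 1)"
  shows "\<exists>C' h'. feasible act Q C' h' \<and> C' \<subseteq> C \<and> length h' = length h + k \<and>
    (\<forall>a. card (group act C a) \<le> 2 ^ k * card (group act C' a))"
  using assms
proof (induction k arbitrary: C h)
  case 0
  then show ?case by auto
next
  case (Suc k)
  have feas: "consistent act Q C h" "quiet h" "Q \<union> C \<subseteq> dom hold" "Q \<inter> C = {}"
     "\<forall>s\<in>Q \<union> C. 1 \<le> act s" "\<exists>s\<in>Q \<union> C. act s = 1"
    using Suc.prems(1) by (auto simp: feasible_def)
  have "finite C" using feas(3) finite_stations finite_subset by blast
  then obtain C1 f where C1: "C1 \<subseteq> C"
    "\<forall>a. card (group act C a) \<le> 2 * card (group act C1 a)"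
    "(\<forall>s\<in>C. \<exists>s'\<in>C1. act s' = act s) \<longrightarrow> consistent act Q C1 (h @ [f])"
    using consistent_step[OF feas(1)] by blast
  have large: "3 * 2 ^ k \<le> card (group act C1 (act s))" if "s \<in> C" for s
  proof -
    have "2 * (3 * 2 ^ k) \<le> card (group act C (act s))" using Suc.prems(2) that by simp
    also have "\<dots> \<le> 2 * card (group act C1 (act s))" using C1(2) by blast
    finally show ?thesis by simp
  qed
  have rep: "\<forall>s\<in>C. \<exists>s'\<in>C1. act s' = act s"
  proof
    fix s assume "s \<in> C"
    have "0 < 3 * (2::nat) ^ k" by simp
    then have "card (group act C1 (act s)) \<noteq> 0" using large[OF \<open>s \<in> C\<close>] by linarith
    then have "group act C1 (act s) \<noteq> {}" by (metis card.empty)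
    then show "\<exists>s'\<in>C1. act s' = act s" by blast
  qed
  have "consistent act Q C1 (h @ [f])" using C1(3) rep by blast
  moreover have first: "\<exists>s\<in>Q \<union> C1. act s = 1"
  proof -
    obtain s where "s \<in> Q \<or> s \<in> C" "act s = 1" using feas(6) by blast
    then show ?thesis using bspec[OF rep, of s] by auto
  qed
  moreover have "3 \<le> card (group act C1 (act s))" if "s \<in> C1" for s
  proof -
    have "3 * 1 \<le> 3 * (2::nat) ^ k" by (intro mult_left_mono) auto
    moreover have "s \<in> C" using that C1(1) by blast
    ultimately show ?thesis using large[of s] by linarith
  qed
  \<comment> \<open>The candidate that was active early enough may have been voted out; a survivor
    of its group has the same activation step.\<close>
  moreover have active: "Q = {} \<or> (\<exists>s\<in>C1. act s + c \<le> length h + 1)"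
  proof (cases "Q = {}")
    case False
    then obtain s where "s \<in> C" "act s + c \<le> length h + 1" using Suc.prems(3) by blast
    moreover from this obtain s' where "s' \<in> C1" "act s' = act s" using rep by blast
    ultimately show ?thesis by (intro disjI2 bexI[of _ s']) simp_all
  qed simp
  ultimately have "quiet (h @ [f])"
    using feas C1(1) by (intro consistent_not_terminated[of act Q C1 h f]) auto
  then have "feasible act Q C1 (h @ [f])"
    using feas C1(1) first \<open>consistent act Q C1 (h @ [f])\<close> by (auto simp: feasible_def)
  moreover have "\<forall>s\<in>C1. 3 * 2 ^ k \<le> card (group act C1 (act s))" using large C1(1) by blast
  moreover have "Q = {} \<or> (\<exists>s\<in>C1. act s + c \<le> length (h @ [f]) + 1)"
    using active by (metis length_append_singleton add_Suc le_SucI)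
  ultimately obtain C' h' where C': "feasible act Q C' h'" "C' \<subseteq> C1"
    "length h' = length (h @ [f]) + k"
    "\<forall>a. card (group act C1 a) \<le> 2 ^ k * card (group act C' a)"
    using Suc.IH[of C1 "h @ [f]"] by blast
  have "card (group act C a) \<le> 2 ^ Suc k * card (group act C' a)" for a
  proof -
    have "card (group act C a) \<le> 2 * card (group act C1 a)" using C1(2) by blast
    also have "\<dots> \<le> 2 * (2 ^ k * card (group act C' a))" using C'(4) by simp
    finally show ?thesis by simp
  qed
  then show ?case using C' C1(1) by (intro exI[of _ C'] exI[of _ h']) auto
qed

section \<open>Phases of \<open>l\<close> steps, each fixing one pair\<close>

text \<open>The state after \<open>i\<close> pairs have been fixed: the candidates for the next pair have
  just been active for \<open>c\<close> steps.\<close>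

definition phase :: "nat \<Rightarrow> nat \<Rightarrow> bool" where
  "phase l i \<longleftrightarrow> (\<exists>act Q C h. feasible act Q C h \<and> length h = i * l + c \<and> card Q = 2 * i \<and>
     (\<forall>s\<in>C. act s = i * l + 1) \<and> 3 * 2 ^ l \<le> card C \<and> card C \<le> 3 * 2 ^ (l + c))"

text \<open>No pair is fixed yet, so \<open>Q\<close> is empty and the run cannot end while the
  first generation of \<open>3 * 2 ^ (l + c)\<close> candidates goes through its \<open>c\<close>
  initial halvings.\<close>

lemma phase_0:
  assumes "3 * 2 ^ (l + c) \<le> card (dom hold)"
  shows "phase l 0"
proof -
  obtain S where S: "S \<subseteq> dom hold" "card S = 3 * 2 ^ (l + c)"
    using assms by (meson obtain_subset_with_card_n)
  let ?act = "\<lambda>_::nat. 1::nat"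
  have "S \<noteq> {}" using S(2) by auto
  then have "feasible ?act {} S []" using S by (auto simp: feasible_def consistent_def quiet_def)
  moreover have "3 * 2 ^ c \<le> card S" using S(2) by (simp add: power_increasing)
  ultimately obtain C h where C: "feasible ?act {} C h" "C \<subseteq> S" "length h = length ([]::feedback list) + c"
    "\<forall>a. card (group ?act S a) \<le> 2 ^ c * card (group ?act C a)"
    using feasible_steps[of ?act "{}" S "[]" c] by auto
  have "card S \<le> 2 ^ c * card C" using C(4)[rule_format, of 1] by simp
  then have "3 * 2 ^ l \<le> card C" using S(2) by (simp add: power_add)
  moreover have "card C \<le> card S"
    using C(2) S(1) finite_stations by (meson card_mono finite_subset)
  ultimately show ?thesis unfolding phase_def
    using C S(2) by (intro exI[of _ ?act] exI[of _ "{}"] exI[of _ C] exI[of _ h]) auto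
qed

text \<open>The old generation runs alone for \<open>l - c\<close> steps and keeps at least
  \<open>3 * 2 ^ c\<close> members. Then a fresh generation starts and both run for \<open>c\<close>
  steps: the old one prevents termination and ends with at least three members, two of which are
  fixed; the new one keeps at least \<open>3 * 2 ^ l\<close>.\<close>

lemma phase_Suc:
  assumes "phase l i" "c \<le> l" and room: "2 * i + 2 * (3 * 2 ^ (l + c)) \<le> card (dom hold)"
    and "0 < l"
  shows "phase l (Suc i)"
proof -
  obtain act Q C h where feas: "feasible act Q C h" and h: "length h = i * l + c"
    and Q: "card Q = 2 * i" and a: "\<forall>s\<in>C. act s = i * l + 1"
    and C: "3 * 2 ^ l \<le> card C" "card C \<le> 3 * 2 ^ (l + c)"
    using assms(1) by (auto simp: phase_def)
  have group_C: "group act C (i * l + 1) = C" using a by auto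
  have "C \<noteq> {}" using C(1) by auto
  have "3 * 2 ^ (l - c) \<le> card C"
  proof -
    have "3 * 2 ^ (l - c) \<le> 3 * (2::nat) ^ l" by (simp add: power_increasing)
    then show ?thesis using C(1) by linarith
  qed
  then have "\<forall>s\<in>C. 3 * 2 ^ (l - c) \<le> card (group act C (act s))" using a group_C by simp
  moreover have "\<exists>s\<in>C. act s + c \<le> length h + 1" using \<open>C \<noteq> {}\<close> a h by auto
  ultimately obtain C1 h1 where C1: "feasible act Q C1 h1" "C1 \<subseteq> C"
    "length h1 = length h + (l - c)"
    "\<forall>a. card (group act C a) \<le> 2 ^ (l - c) * card (group act C1 a)"
    using feasible_steps[OF feas] by blast
  have h1: "length h1 = Suc i * l" using C1(3) h \<open>c \<le> l\<close> by simp
  have "group act C1 (i * l + 1) = C1" using a C1(2) by auto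
  then have "3 * 2 ^ l \<le> 2 ^ (l - c) * card C1"
    using C1(4)[rule_format, of "i * l + 1"] group_C C(1) by simp
  moreover have "(2::nat) ^ l = 2 ^ (l - c) * 2 ^ c"
    using \<open>c \<le> l\<close> by (simp flip: power_add)
  ultimately have card_C1: "3 * 2 ^ c \<le> card C1" by (simp add: mult.left_commute)
  have fin: "finite C" using feas finite_stations finite_subset unfolding feasible_def by blast
  have sub: "Q \<union> C1 \<subseteq> dom hold" using C1(1) by (simp add: feasible_def)
  have "card (Q \<union> C1) \<le> 2 * i + 3 * 2 ^ (l + c)"
    using card_Un_le[of Q C1] Q C(2) card_mono[OF fin C1(2)] by linarith
  then have "3 * 2 ^ (l + c) \<le> card (dom hold - (Q \<union> C1))"
    using room card_Diff_subset[of "Q \<union> C1" "dom hold"] sub finite_stations finite_subset by fastforce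
  then obtain S where S: "S \<subseteq> dom hold - (Q \<union> C1)" "card S = 3 * 2 ^ (l + c)"
    by (meson obtain_subset_with_card_n)
  define act' where "act' s = (if s \<in> S then Suc i * l + 1 else act s)" for s
  have eq: "act' s = act s" if "s \<in> Q \<union> C1" for s using that S(1) by (auto simp: act'_def)
  have "consistent act' Q (C1 \<union> S) h1"
    using C1(1) S(1) h1 eq by (intro consistent_activate[of act]) (auto simp: feasible_def act'_def)
  moreover have "\<exists>s\<in>Q \<union> C1. act' s = 1"
  proof -
    obtain s where "s \<in> Q \<union> C1" "act s = 1" using C1(1) by (auto simp: feasible_def)
    then show ?thesis using eq by auto
  qed
  moreover have "\<forall>s\<in>Q \<union> C1 \<union> S. 1 \<le> act' s"
    using C1(1) by (auto simp: feasible_def act'_def)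
  ultimately have feas': "feasible act' Q (C1 \<union> S) h1"
    using C1(1) S(1) by (auto simp: feasible_def)
  have old: "act' s = i * l + 1" if "s \<in> C1" for s using that eq a C1(2) by auto
  have new: "act' s = Suc i * l + 1" if "s \<in> S" for s using that by (simp add: act'_def)
  have groups: "group act' (C1 \<union> S) (i * l + 1) = C1" "group act' (C1 \<union> S) (Suc i * l + 1) = S"
    using old new \<open>0 < l\<close> by fastforce+
  have "3 * 2 ^ c \<le> card S" using S(2) by (simp add: power_increasing)
  then have "\<forall>s\<in>C1 \<union> S. 3 * 2 ^ c \<le> card (group act' (C1 \<union> S) (act' s))"
    using old new groups card_C1 by (metis UnE)
  \<comment> \<open>By \<open>c \<le> l\<close> the old candidates started at least \<open>c\<close>
    steps before the coming step \<open>Suc i * l + 1\<close>.\<close>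
  moreover have "\<exists>s\<in>C1 \<union> S. act' s + c \<le> length h1 + 1"
  proof -
    have "C1 \<noteq> {}" using card_C1 by auto
    then obtain s where "s \<in> C1" by blast
    then have "act' s + c \<le> length h1 + 1" using old[of s] h1 \<open>c \<le> l\<close> by simp
    then show ?thesis using \<open>s \<in> C1\<close> by blast
  qed
  ultimately obtain C2 h2 where C2: "feasible act' Q C2 h2" "C2 \<subseteq> C1 \<union> S"
    "length h2 = length h1 + c"
    "\<forall>a. card (group act' (C1 \<union> S) a) \<le> 2 ^ c * card (group act' C2 a)"
    using feasible_steps[OF feas'] by blast
  let ?P = "group act' C2 (i * l + 1)" and ?S = "group act' C2 (Suc i * l + 1)"
  have C2_eq: "C2 = ?P \<union> ?S" using C2(2) old new by auto
  have S_eq: "C2 - ?P = ?S" using C2_eq \<open>0 < l\<close> by fastforce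
  \<comment> \<open>After \<open>c\<close> halvings at least three old candidates remain, enough to
    choose a pair.\<close>
  have "3 * 2 ^ c \<le> 2 ^ c * card ?P"
    using C2(4)[rule_format, of "i * l + 1"] groups(1) card_C1 by (metis le_trans)
  then have "2 \<le> card ?P" by simp
  then obtain D where D: "D \<subseteq> ?P" "card D = 2" by (meson obtain_subset_with_card_n)
  have "3 * 2 ^ (l + c) \<le> 2 ^ c * card ?S"
    using C2(4)[rule_format, of "Suc i * l + 1"] groups(2) S(2) by metis
  then have S_large: "3 * 2 ^ l \<le> card ?S" by (simp add: power_add)
  have "?S \<subseteq> S" using C2(2) old \<open>0 < l\<close> by fastforce
  then have S_small: "card ?S \<le> 3 * 2 ^ (l + c)"
    using S finite_stations by (metis card_mono finite_Diff finite_subset)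
  obtain x y where xy: "D = {x, y}" "x \<noteq> y" using D(2) by (auto simp: card_2_iff)
  have "consistent act' (Q \<union> D) (C2 - ?P) h2"
  proof (rule consistent_commit)
    show "consistent act' Q C2 h2" using C2(1) by (simp add: feasible_def)
    show "\<exists>x\<in>D. \<exists>y\<in>D. x \<noteq> y \<and> act' x = act' s \<and> act' y = act' s" if "s \<in> ?P" for s
      using that xy D(1) by auto
  qed (use D in auto)
  moreover have "\<exists>s\<in>Q \<union> D \<union> ?S. act' s = 1"
  proof -
    obtain s where s: "s \<in> Q \<union> C2" "act' s = 1" using C2(1) by (auto simp: feasible_def)
    consider "s \<in> Q" | "s \<in> ?P" | "s \<in> ?S" using s C2_eq by blast
    then show ?thesis
    proof cases
      \<comment> \<open>Here the old generation started at step 1, and so did the fixed station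
        \<open>x\<close>.\<close>
      case 2
      then have "act' x = 1" using s xy D(1) by auto
      then show ?thesis using xy by blast
    qed (use s in auto)
  qed
  ultimately have "feasible act' (Q \<union> D) ?S h2"
    using C2(1) D(1) \<open>0 < l\<close> unfolding S_eq by (auto simp: feasible_def)
  moreover have "card (Q \<union> D) = 2 * Suc i"
  proof -
    have "Q \<inter> D = {}" using C2(1) D(1) by (auto simp: feasible_def)
    moreover have "finite Q" using sub finite_stations finite_subset by blast
    ultimately show ?thesis using Q D xy by (simp add: card_Un_disjoint)
  qed
  ultimately show ?thesis unfolding phase_def
    using S_large S_small C2(3) h1
    by (intro exI[of _ act'] exI[of _ "Q \<union> D"] exI[of _ ?S] exI[of _ h2]) auto
qed

section \<open>The forced running time and the constants\<close>

text \<open>The state after \<open>r\<close> phases becomes a run on the whole input: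
  \<open>Q\<close> and all of \<open>C\<close> start as recorded and produce \<open>h\<close>, which
  has length \<open>r * l + c\<close> and contains no termination signal.\<close>

lemma long_run:
  assumes "c \<le> l" "0 < l" and room: "2 * r + 2 * (3 * 2 ^ (l + c)) \<le> card (dom hold)"
  shows "\<exists>act T. valid_schedule hold act \<and> terminates_at A n hold act T \<and> r * l \<le> T"
proof -
  have "phase l i" if "i \<le> r" for i
    using that
  proof (induction i)
    case 0
    show ?case using room by (intro phase_0) linarith
  next
    case (Suc i)
    then show ?case using assms by (intro phase_Suc) auto
  qed
  then obtain act Q C h where feas: "feasible act Q C h" and h: "length h = r * l + c"
    and a: "\<forall>s\<in>C. act s = r * l + 1" and C: "3 * 2 ^ l \<le> card C"
    unfolding phase_def by blast
  have con: "consistent act Q C h" and sub: "Q \<union> C \<subseteq> dom hold" using feas by (auto simp: feasible_def)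
  have "3 * 1 \<le> 3 * (2::nat) ^ l" by (intro mult_left_mono) auto
  then have "2 \<le> card C" using C by linarith
  then obtain D where "D \<subseteq> C" "card D = 2" by (meson obtain_subset_with_card_n)
  then obtain x y where xy: "x \<in> C" "y \<in> C" "x \<noteq> y" by (auto simp: card_2_iff)
  have tr: "transcript A n (hold |` (Q \<union> C)) act (length h) = h"
    using xy a by (intro transcript_consistent[OF con]) auto
  \<comment> \<open>The other stations belong to the input too; starting one step after the end of
    \<open>h\<close>, they leave it unchanged.\<close>
  define act' where "act' s = (if s \<in> Q \<union> C then act s else length h + 1)" for s
  have "transcript A n hold act' (length h) = h"
  proof (rule transcript_eqI)
    fix i assume i: "i < length h"
    have "h ! i = channel_feedback A n (hold |` (Q \<union> C)) act (take i h)"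
      using tr take_transcript[of i "length h"] take_transcript[of "Suc i" "length h"] i
      by (metis Suc_leI length_transcript less_imp_le nth_append_length nth_take lessI transcript.simps(2))
    also have "\<dots> = channel_feedback A n hold act' (take i h)"
    proof (rule channel_feedback_cong)
      fix s
      show "action A n (hold |` (Q \<union> C)) act (take i h) s = action A n hold act' (take i h) s"
      proof (cases "s \<in> Q \<union> C")
        case True
        then show ?thesis by (simp add: action_restrict act'_def action_cong[of act' s act])
      next
        case False
        then show ?thesis using i
          by (simp add: action_restrict act'_def action_before_activation)
      qed
    qed
    finally show "h ! i = channel_feedback A n hold act' (take i h)" .
  qed
  moreover have valid: "valid_schedule hold act'"
    using feas sub by (auto simp: valid_schedule_def feasible_def act'_def)
  moreover have "distributes (ran hold) hold" using inj_hold by (simp add: distributes_def)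
  then obtain T where "terminates_at A n hold act' T"
    using correct simple valid unfolding c_correct_def by blast
  moreover have "quiet h" using feas by (simp add: feasible_def)
  ultimately have "length h < T" using terminates_atD_quiet[of A n hold act' T "length h"] by simp
  then show ?thesis using valid \<open>terminates_at A n hold act' T\<close> h
    by (intro exI[of _ act'] exI[of _ T]) auto
qed

end

lemma distributes_card:
  assumes "distributes E hold"
  shows "card (dom hold) = card E"
proof -
  have "hold ` dom hold = Some ` E" using assms by (force simp: distributes_def ran_def)
  then have "card (hold ` dom hold) = card E" by (simp add: card_image)
  then show ?thesis using assms by (simp add: distributes_def card_image)
qed

text \<open>Take for \<open>l\<close> the integer part of the base-4 logarithm of \<open>m\<close>.
  Then \<open>2 ^ l\<close> is at most the square root of \<open>m\<close>, which keeps a generation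
  of candidates small, while \<open>l\<close> is still of order \<open>log 2 m\<close>.\<close>

lemma phase_length_exists:
  fixes m :: nat
  assumes m: "144 * 4 ^ c \<le> m"
  obtains l where "c \<le> l" "0 < l" "4 * (3 * 2 ^ (l + c)) \<le> m" "log 2 (real m) \<le> 4 * real l"
proof -
  have "1 \<le> m" using m by (metis (no_types) le_trans mult_le_mono one_le_numeral one_le_power mult_1)
  then obtain l where l: "4 ^ l \<le> m" "m < 4 ^ (l + 1)"
    using ex_power_ivl1[of 4 m] by auto
  have "(4::nat) ^ (c + 1) \<le> 144 * 4 ^ c" by simp
  then have "(4::nat) ^ (c + 1) < 4 ^ (l + 1)" using l(2) m by linarith
  then have "c + 1 < l + 1" by (rule power_less_imp_less_exp[rotated]) simp
  then have cl: "c < l" by simp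
  \<comment> \<open>Both sides are compared after squaring, and 144 is the square of
    \<open>4 * 3\<close>: one factor \<open>m\<close> absorbs \<open>144 * 4 ^ c\<close>, the other
    \<open>4 ^ l\<close>.\<close>
  have "(2 ^ (l + c))\<^sup>2 = (4::nat) ^ (l + c)"
    using power_even_eq[of "2::nat" "l + c"] power_mult[of "2::nat" 2 "l + c"] by simp
  then have "(4 * (3 * 2 ^ (l + c)))\<^sup>2 = 144 * 4 ^ c * (4::nat) ^ l"
    by (simp add: power_mult_distrib power_add)
  also have "\<dots> \<le> m * m" using m l(1) by (intro mult_le_mono)
  finally have "4 * (3 * 2 ^ (l + c)) \<le> m" by (simp only: power2_nat_le_eq_le flip: power2_eq_square)
  moreover have "log 2 (real m) \<le> 4 * real l"
  proof -
    have "real m \<le> 4 ^ (l + 1)" using l(2) by (metis less_imp_le of_nat_le_iff of_nat_numeral of_nat_power)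
    also have "\<dots> = 2 ^ (2 * (l + 1))" by (simp add: power_mult)
    finally have "log 2 (real m) \<le> log 2 (2 ^ (2 * (l + 1)))" using \<open>1 \<le> m\<close> by (intro log_mono) auto
    also have "\<dots> = 2 * real (l + 1)" by (subst log_nat_power) auto
    \<comment> \<open>\<open>2 * (l + 1) \<le> 4 * l\<close> because \<open>l\<close> is at least
      1.\<close>
    finally show ?thesis using cl by simp
  qed
  ultimately show ?thesis using that[of l] cl by linarith
qed

theorem theorem6:
  "\<exists>d::real. d > 0 \<and>
     (\<forall>c::nat. c > 0 \<longrightarrow>
       (\<exists>M::nat. \<forall>A::algorithm. c_correct c A \<and> outputs_input_edges A \<longrightarrow>
         (\<forall>(m::nat) (n::nat) (G::edge set) (hold::assignment).
            m > 0 \<and> m \<ge> M \<and>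
            simple_graph n G \<and> forest G \<and> card G = m \<and> distributes G hold \<longrightarrow>
            (\<exists>(act::schedule) (T::nat).
               valid_schedule hold act \<and>
               terminates_at A n hold act T \<and>
               real T \<ge> d * (real m * log 2 (real m))))))"
proof (rule exI[of _ "1/32"], intro conjI allI impI)
  \<comment> \<open>A factor 8 is lost between \<open>m\<close> and \<open>m div 4\<close>, and a
    factor 4 between \<open>log 2 m\<close> and \<open>l\<close>. Only the threshold
    \<open>M\<close> depends on \<open>c\<close>.\<close>
  show "(0::real) < 1/32" by simp
  fix c :: nat
  show "\<exists>M::nat. \<forall>A::algorithm. c_correct c A \<and> outputs_input_edges A \<longrightarrow>
         (\<forall>(m::nat) (n::nat) (G::edge set) (hold::assignment).
            m > 0 \<and> m \<ge> M \<and>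
            simple_graph n G \<and> forest G \<and> card G = m \<and> distributes G hold \<longrightarrow>
            (\<exists>(act::schedule) (T::nat).
               valid_schedule hold act \<and>
               terminates_at A n hold act T \<and>
               real T \<ge> 1/32 * (real m * log 2 (real m))))"
  proof (rule exI[of _ "144 * 4 ^ c"], intro allI impI, elim conjE)
    fix A :: algorithm and m n :: nat and G :: "edge set" and hold :: assignment
    assume A: "c_correct c A" "outputs_input_edges A" and "m > 0" and m: "m \<ge> 144 * 4 ^ c"
      and G: "simple_graph n G" "forest G" "card G = m" "distributes G hold"
    have dom: "card (dom hold) = m" using distributes_card G by simp
    then have "finite (dom hold)" using \<open>m > 0\<close> by (simp add: card_ge_0_finite)
    then interpret adversary A n hold c
      using A G by unfold_locales (auto simp: distributes_def)
    obtain l where l: "c \<le> l" "0 < l" "4 * (3 * 2 ^ (l + c)) \<le> m" "log 2 (real m) \<le> 4 * real l"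
      using phase_length_exists[OF m] .
    \<comment> \<open>The \<open>m div 4\<close> pairs take at most half of the stations, and two
      generations of candidates fit into the other half.\<close>
    have "2 * (m div 4) + 2 * (3 * 2 ^ (l + c)) \<le> card (dom hold)" using dom l(3) by linarith
    then obtain act T where T: "valid_schedule hold act" "terminates_at A n hold act T"
      "m div 4 * l \<le> T"
      using long_run[OF l(1,2)] by blast
    have "(1::nat) \<le> 4 ^ c" by simp
    then have "m \<le> 8 * (m div 4)" using m by linarith
    then have "real m \<le> 8 * real (m div 4)" by linarith
    then have "real m * log 2 (real m) \<le> (8 * real (m div 4)) * (4 * real l)"
      using l(4) \<open>m > 0\<close> by (intro mult_mono) auto
    also have "\<dots> = 32 * real (m div 4 * l)" by simp
    also have "\<dots> \<le> 32 * real T" using T(3) by (simp only: of_nat_le_iff mult_le_cancel_left_pos)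
    finally show "\<exists>(act::schedule) (T::nat). valid_schedule hold act \<and>
        terminates_at A n hold act T \<and> real T \<ge> 1/32 * (real m * log 2 (real m))"
      using T by (intro exI[of _ act] exI[of _ T]) auto
  qed
qed

end
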